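(* Let $H_1$ and $H_2$ both be graphs on $k$ vertices, and let $G$ be a star graph. If $H_1$ and $H_2$ have the same degree sequence, then $X_G^{H_1} = X_G^{H_2}$.
   Context: All graphs are finite, simple, undirected, with at least one vertex. A star graph is a complete bipartite graph $K_{1,s}$ with $s\ge 1$. The degree sequence of a graph $H$ on $k$ vertices is $D=(d_1,d_2,\dots,d_k)$ where $d_i=|\{v\in V(H):\deg(v)=i\}|$. $H$-chromatic symmetric function: let $G,H$ be graphs with $|V(G)|=k$, $|V(H)|=N$. A labeling of $H$ is a bijection $\phi:V(H)\to[N]$. A proper $(H,\phi)$-coloring of $G$ is a map $\kappa:V(G)\to[N]$ such that whenever $u,v$ are adjacent in $G$, $\phi^{-1}(\kappa(u))$ and $\phi^{-1}(\kappa(v))$ are adjacent in $H$. Put $w_G^H=\sum_\phi\sum_\kappa\prod_{v\in V(G)}x_{\kappa(v)}$, summed over all labelings $\phi$ and all proper $(H,\phi)$-colorings $\kappa$. This is a symmetric polynomial in $x_1,\dots,x_N$, homogeneous of degree $k$; writing $w_G^H=\sum_{\lambda\vdash k,\,l(\lambda)\le N}c_\lambda m_\lambda(x_1,\dots,x_N)$ (with $m_\lambda$ the monomial symmetric functions and $l(\lambda)$ the number of parts), define $X_G^H=\sum_{\lambda\vdash k,\,l(\lambda)\le N}c_\lambda m_\lambda\in\Lambda^k$ (so $X_G^H=0$ if there are no proper colorings). *)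

theory Defs
  imports
    "Graph_Theory.Graph_Theory"
    "HOL-Library.Poly_Mapping"
    "HOL-Library.FuncSet"
    "HOL-Library.Multiset"
    "HOL-Combinatorics.Permutations"
begin

section \<open>Graphs\<close>

text \<open>
  A finite simple undirected graph is a \<^locale>\<open>pair_graph\<close>: every edge \<open>{u, v}\<close> is stored
  as the two arcs \<open>(u, v)\<close> and \<open>(v, u)\<close>, so the degree of a vertex is its out-degree.
\<close>

definition simple_graph :: "'a pair_pre_digraph \<Rightarrow> bool" where
  "simple_graph G \<longleftrightarrow> pair_graph G \<and> pverts G \<noteq> {}"

definition star_graph :: "'a pair_pre_digraph \<Rightarrow> bool" where
  "star_graph G \<longleftrightarrow> (\<exists>s\<ge>1. complete_bipartite_digraph 1 s (with_proj G))"

text \<open>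
  The \<open>i\<close>-th entry, for \<open>i = 1, ..., k\<close> with \<open>k\<close> the number of vertices, counts the vertices of
  degree \<open>i\<close>; isolated vertices are not recorded.
\<close>

definition degree_sequence :: "'a pair_pre_digraph \<Rightarrow> nat list" where
  "degree_sequence H =
     map (\<lambda>i. card {v \<in> pverts H. out_degree (with_proj H) v = i}) [1..<Suc (card (pverts H))]"

section \<open>Symmetric polynomials and symmetric functions\<close>

text \<open>
  A monomial is its finitely supported exponent function. A polynomial has finitely many monomials;
  an element of \<open>\<Lambda>\<close> is a formal power series in \<open>x\<^sub>1, x\<^sub>2, ...\<close>, given by its coefficient function.
\<close>

type_synonym monomial = "nat \<Rightarrow>\<^sub>0 nat"
type_synonym polynomial = "monomial \<Rightarrow>\<^sub>0 int"
type_synonym power_series = "monomial \<Rightarrow> int"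

definition var :: "nat \<Rightarrow> polynomial" where
  "var i = Poly_Mapping.single (Poly_Mapping.single i 1) 1"

definition exponents :: "monomial \<Rightarrow> nat multiset" where
  "exponents e = image_mset (Poly_Mapping.lookup e) (mset_set (Poly_Mapping.keys e))"

text \<open>Integer partitions of \<open>k\<close> with at most \<open>N\<close> parts, as multisets of positive parts.\<close>

definition partitions :: "nat \<Rightarrow> nat \<Rightarrow> nat multiset set" where
  "partitions k N = {l. 0 \<notin># l \<and> sum_mset l = k \<and> size l \<le> N}"

text \<open>The polynomial \<open>m\<^sub>\<lambda>(x\<^sub>1, ..., x\<^sub>N)\<close> and the symmetric function \<open>m\<^sub>\<lambda>\<close>.\<close>

definition monomial_sym_poly :: "nat \<Rightarrow> nat multiset \<Rightarrow> polynomial" where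
  "monomial_sym_poly N l =
     (\<Sum>e \<in> {e. Poly_Mapping.keys e \<subseteq> {1..N} \<and> exponents e = l}. Poly_Mapping.single e 1)"

definition monomial_sym :: "nat multiset \<Rightarrow> power_series" where
  "monomial_sym l = (\<lambda>e. if Poly_Mapping.keys e \<subseteq> {1..} \<and> exponents e = l then 1 else 0)"

section \<open>The \<open>H\<close>-chromatic symmetric function\<close>

text \<open>
  Labelings and colorings are \<^const>\<open>extensional\<close>, so that each map on the vertex set is counted
  exactly once.
\<close>

definition labelings :: "'b pair_pre_digraph \<Rightarrow> ('b \<Rightarrow> nat) set" where
  "labelings H = {\<phi> \<in> extensional (pverts H). bij_betw \<phi> (pverts H) {1..card (pverts H)}}"

definition proper_colorings ::
    "'a pair_pre_digraph \<Rightarrow> 'b pair_pre_digraph \<Rightarrow> ('b \<Rightarrow> nat) \<Rightarrow> ('a \<Rightarrow> nat) set" where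
  "proper_colorings G H \<phi> =
     {\<kappa> \<in> pverts G \<rightarrow>\<^sub>E {1..card (pverts H)}.
        \<forall>(u, v) \<in> parcs G.
          (the_inv_into (pverts H) \<phi> (\<kappa> u), the_inv_into (pverts H) \<phi> (\<kappa> v)) \<in> parcs H}"

definition H_chromatic_poly :: "'a pair_pre_digraph \<Rightarrow> 'b pair_pre_digraph \<Rightarrow> polynomial" where
  "H_chromatic_poly G H =
     (\<Sum>\<phi> \<in> labelings H. \<Sum>\<kappa> \<in> proper_colorings G H \<phi>. \<Prod>v \<in> pverts G. var (\<kappa> v))"

definition is_monomial_expansion ::
    "'a pair_pre_digraph \<Rightarrow> 'b pair_pre_digraph \<Rightarrow> (nat multiset \<Rightarrow> int) \<Rightarrow> bool" where
  "is_monomial_expansion G H c \<longleftrightarrow>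
     (\<forall>l. l \<notin> partitions (card (pverts G)) (card (pverts H)) \<longrightarrow> c l = 0) \<and>
     H_chromatic_poly G H =
       (\<Sum>l \<in> partitions (card (pverts G)) (card (pverts H)).
          of_int (c l) * monomial_sym_poly (card (pverts H)) l)"

text \<open>The description is proper: see \<open>ex1_monomial_expansion\<close> below.\<close>

definition monomial_coeff ::
    "'a pair_pre_digraph \<Rightarrow> 'b pair_pre_digraph \<Rightarrow> nat multiset \<Rightarrow> int" where
  "monomial_coeff G H = (THE c. is_monomial_expansion G H c)"

definition H_chromatic_sym :: "'a pair_pre_digraph \<Rightarrow> 'b pair_pre_digraph \<Rightarrow> power_series" where
  "H_chromatic_sym G H =
     (\<lambda>e. \<Sum>l \<in> partitions (card (pverts G)) (card (pverts H)).
        monomial_coeff G H l * monomial_sym l e)"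

section \<open>Existence and uniqueness of the monomial expansion\<close>

lemma finite_partitions: "finite (partitions k N)"
proof (rule finite_subset)
  show "partitions k N \<subseteq> mset ` {xs. set xs \<subseteq> {..k} \<and> length xs \<le> N}"
  proof
    fix l assume l: "l \<in> partitions k N"
    obtain xs where xs: "l = mset xs" by (metis ex_mset)
    have "set xs \<subseteq> {..k}"
      using l xs by (auto simp: partitions_def sum_mset_sum_list member_le_sum_list)
    moreover have "length xs \<le> N" using l xs by (simp add: partitions_def)
    ultimately show "l \<in> mset ` {xs. set xs \<subseteq> {..k} \<and> length xs \<le> N}" using xs by blast
  qed
qed (simp add: finite_lists_length_le)

lemma size_exponents: "size (exponents e) = card (Poly_Mapping.keys e)"
  by (simp add: exponents_def)

lemma sum_exponents: "sum_mset (exponents e) = (\<Sum>i\<in>Poly_Mapping.keys e. Poly_Mapping.lookup e i)"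
  by (simp add: exponents_def sum_unfold_sum_mset)

lemma exponents_interval:
  assumes "Poly_Mapping.keys e \<subseteq> {1..N}"
  shows "image_mset (Poly_Mapping.lookup e) (mset_set {1..N}) =
         exponents e + replicate_mset (N - size (exponents e)) 0"
proof -
  let ?K = "Poly_Mapping.keys e"
  have "mset_set {1..N} = mset_set (?K \<union> ({1..N} - ?K))" using assms by (simp add: Un_absorb1)
  also have "\<dots> = mset_set ?K + mset_set ({1..N} - ?K)" by (subst mset_set_Union) auto
  finally have "image_mset (Poly_Mapping.lookup e) (mset_set {1..N}) =
      exponents e + image_mset (Poly_Mapping.lookup e) (mset_set ({1..N} - ?K))"
    by (simp add: exponents_def)
  also have "image_mset (Poly_Mapping.lookup e) (mset_set ({1..N} - ?K)) =
      image_mset (\<lambda>_. 0) (mset_set ({1..N} - ?K))"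
    by (intro image_mset_cong) (auto simp: in_keys_iff)
  also have "\<dots> = replicate_mset (N - size (exponents e)) 0"
    using assms by (simp add: image_mset_const_eq size_exponents card_Diff_subset)
  finally show ?thesis .
qed

lemma exponents_eq_imp_permutes:
  assumes "Poly_Mapping.keys e \<subseteq> {1..N}" "Poly_Mapping.keys e' \<subseteq> {1..N}"
    and "exponents e = exponents e'"
  obtains p where "p permutes {1..N}" "\<And>i. Poly_Mapping.lookup e' (p i) = Poly_Mapping.lookup e i"
proof -
  have "image_mset (Poly_Mapping.lookup e) (mset_set {1..N}) =
        image_mset (Poly_Mapping.lookup e') (mset_set {1..N})"
    using assms by (simp only: exponents_interval)
  then obtain p where p: "p permutes {1..N}"
      "\<forall>i\<in>{1..N}. Poly_Mapping.lookup e i = Poly_Mapping.lookup e' (p i)"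
    using image_mset_eq_implies_permutes[OF finite_atLeastAtMost] by metis
  have "Poly_Mapping.lookup e' (p i) = Poly_Mapping.lookup e i" for i
  proof (cases "i \<in> {1..N}")
    case False
    then have "i \<notin> Poly_Mapping.keys e" "i \<notin> Poly_Mapping.keys e'" "p i = i"
      using assms permutes_not_in[OF p(1)] by blast+
    then show ?thesis by (simp add: in_keys_iff)
  qed (use p in simp)
  with p(1) show ?thesis by (rule that)
qed

lemma ex_exponents:
  assumes "l \<in> partitions k N"
  shows "\<exists>e. Poly_Mapping.keys e \<subseteq> {1..N} \<and> exponents e = l"
proof -
  obtain xs where xs: "l = mset xs" by (metis ex_mset)
  let ?n = "length xs"
  define e :: monomial where "e = Poly_Mapping.nth (0 # xs)"
  have lk: "Poly_Mapping.lookup e i = nth_default 0 (0 # xs) i" for i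
    by (simp add: e_def)
  have nz: "x \<noteq> 0" if "x \<in> set xs" for x
    using assms xs that by (metis (no_types, lifting) mem_Collect_eq partitions_def set_mset_mset)
  have "Poly_Mapping.lookup e i \<noteq> 0 \<longleftrightarrow> i \<in> {1..<Suc ?n}" for i
    using nz by (cases i) (auto simp: lk nth_default_def)
  then have keys: "Poly_Mapping.keys e = {1..<Suc ?n}"
    unfolding set_eq_iff in_keys_iff by blast
  have "exponents e = mset (map (Poly_Mapping.lookup e) [1..<Suc ?n])"
    unfolding exponents_def keys by (metis mset_map mset_upt)
  also have "map (Poly_Mapping.lookup e) [1..<Suc ?n] = xs"
    by (rule nth_equalityI) (simp_all add: lk nth_default_def del: upt_Suc)
  finally have "exponents e = l" using xs by simp
  moreover have "?n \<le> N" using assms xs by (simp add: partitions_def)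
  then have "Poly_Mapping.keys e \<subseteq> {1..N}" using keys by auto
  ultimately show ?thesis by blast
qed

lemma finite_exponents_eq:
  "finite {e. Poly_Mapping.keys e \<subseteq> {1..N} \<and> exponents e = l}" (is "finite ?E")
proof (rule finite_imageD)
  show "finite ((\<lambda>e. restrict (Poly_Mapping.lookup e) {1..N}) ` ?E)"
  proof (rule finite_subset)
    have "Poly_Mapping.lookup e i \<le> sum_mset l" if "exponents e = l" for e i
    proof (cases "i \<in> Poly_Mapping.keys e")
      case True
      then show ?thesis unfolding that[symmetric] sum_exponents
        by (intro member_le_sum) auto
    qed (simp add: in_keys_iff)
    then show "(\<lambda>e. restrict (Poly_Mapping.lookup e) {1..N}) ` ?E \<subseteq> {1..N} \<rightarrow>\<^sub>E {..sum_mset l}"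
      by auto
    show "finite ({1..N} \<rightarrow>\<^sub>E {..sum_mset l})" by (intro finite_PiE) auto
  qed
  show "inj_on (\<lambda>e. restrict (Poly_Mapping.lookup e) {1..N}) ?E"
  proof (rule inj_onI, rule poly_mapping_eqI)
    fix e e' i assume A: "e \<in> ?E" "e' \<in> ?E"
      and eq: "restrict (Poly_Mapping.lookup e) {1..N} = restrict (Poly_Mapping.lookup e') {1..N}"
    show "Poly_Mapping.lookup e i = Poly_Mapping.lookup e' i"
    proof (cases "i \<in> {1..N}")
      case True then show ?thesis using fun_cong[OF eq, of i] by simp
    next
      case False
      then have "i \<notin> Poly_Mapping.keys e" "i \<notin> Poly_Mapping.keys e'" using A by blast+
      then show ?thesis by (simp add: in_keys_iff)
    qed
  qed
qed

lemma lookup_monomial_sym_poly: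
  "Poly_Mapping.lookup (monomial_sym_poly N l) e =
     (if Poly_Mapping.keys e \<subseteq> {1..N} \<and> exponents e = l then 1 else 0)"
  unfolding monomial_sym_poly_def lookup_sum lookup_single when_def
    sum.delta[OF finite_exponents_eq] by simp

lemma lookup_of_int_mult:
  "Poly_Mapping.lookup (of_int c * p) e = c * Poly_Mapping.lookup (p :: polynomial) e"
proof -
  have "of_int c * p = Poly_Mapping.map ((*) c) p"
    by (metis mult_map_scale_conv_mult of_int_eq_id id_apply single_of_int)
  then show ?thesis by (simp add: Poly_Mapping.map.rep_eq when_def)
qed

lemma lookup_expansion:
  "Poly_Mapping.lookup (\<Sum>l \<in> partitions k N. of_int (c l) * monomial_sym_poly N l) e =
     (if Poly_Mapping.keys e \<subseteq> {1..N} \<and> exponents e \<in> partitions k N then c (exponents e) else 0)"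
proof -
  have "Poly_Mapping.lookup (\<Sum>l \<in> partitions k N. of_int (c l) * monomial_sym_poly N l) e =
    (\<Sum>l \<in> partitions k N. if l = exponents e
        then if Poly_Mapping.keys e \<subseteq> {1..N} then c l else 0 else 0)"
    unfolding lookup_sum lookup_of_int_mult lookup_monomial_sym_poly
    by (intro sum.cong) auto
  then show ?thesis by (simp add: sum.delta[OF finite_partitions])
qed

definition exponent_of :: "'a pair_pre_digraph \<Rightarrow> ('a \<Rightarrow> nat) \<Rightarrow> monomial" where
  "exponent_of G \<kappa> = (\<Sum>v \<in> pverts G. Poly_Mapping.single (\<kappa> v) 1)"

lemma prod_var: "(\<Prod>v \<in> pverts G. var (\<kappa> v)) = Poly_Mapping.single (exponent_of G \<kappa>) 1"
proof -
  have "(\<Prod>v \<in> A. var (\<kappa> v)) = Poly_Mapping.single (\<Sum>v \<in> A. Poly_Mapping.single (\<kappa> v) 1) 1" for A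
    by (induction A rule: infinite_finite_induct) (simp_all add: var_def mult_single)
  then show ?thesis by (simp add: exponent_of_def)
qed

lemma lookup_exponent_of:
  "Poly_Mapping.lookup (exponent_of G \<kappa>) i = (\<Sum>v \<in> pverts G. if \<kappa> v = i then 1 else 0)"
  unfolding exponent_of_def lookup_sum lookup_single when_def by (rule refl)

lemma finite_labelings:
  assumes "finite (pverts H)"
  shows "finite (labelings H)"
proof (rule finite_subset)
  show "labelings H \<subseteq> pverts H \<rightarrow>\<^sub>E {1..card (pverts H)}"
    by (auto simp: labelings_def PiE_def bij_betw_def)
  show "finite (pverts H \<rightarrow>\<^sub>E {1..card (pverts H)})"
    using assms by (intro finite_PiE) auto
qed

lemma finite_proper_colorings:
  assumes "finite (pverts G)"
  shows "finite (proper_colorings G H \<phi>)"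
proof (rule finite_subset)
  show "proper_colorings G H \<phi> \<subseteq> pverts G \<rightarrow>\<^sub>E {1..card (pverts H)}"
    unfolding proper_colorings_def by (rule Collect_restrict)
  show "finite (pverts G \<rightarrow>\<^sub>E {1..card (pverts H)})"
    using assms by (intro finite_PiE) auto
qed

lemma lookup_H_chromatic_poly:
  assumes "finite (pverts G)" "finite (pverts H)"
  shows "Poly_Mapping.lookup (H_chromatic_poly G H) e =
    (\<Sum>(\<phi>, \<kappa>) \<in> Sigma (labelings H) (proper_colorings G H). if exponent_of G \<kappa> = e then 1 else 0)"
proof -
  have "Poly_Mapping.lookup (H_chromatic_poly G H) e =
      (\<Sum>\<phi> \<in> labelings H. \<Sum>\<kappa> \<in> proper_colorings G H \<phi>. if exponent_of G \<kappa> = e then 1 else 0)"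
    unfolding H_chromatic_poly_def prod_var lookup_sum lookup_single when_def by (rule refl)
  also have "\<dots> = (\<Sum>(\<phi>, \<kappa>) \<in> Sigma (labelings H) (proper_colorings G H).
      if exponent_of G \<kappa> = e then 1 else 0)"
    using assms by (intro sum.Sigma) (simp_all add: finite_labelings finite_proper_colorings)
  finally show ?thesis .
qed

lemma permute_labeling_coloring:
  assumes wf: "pair_wf_digraph G" and p: "p permutes {1..card (pverts H)}"
    and phi: "\<phi> \<in> labelings H" and kappa: "\<kappa> \<in> proper_colorings G H \<phi>"
  shows "restrict (p \<circ> \<phi>) (pverts H) \<in> labelings H"
    and "restrict (p \<circ> \<kappa>) (pverts G) \<in> proper_colorings G H (restrict (p \<circ> \<phi>) (pverts H))"
proof -
  let ?N = "{1..card (pverts H)}"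
  let ?\<phi> = "restrict (p \<circ> \<phi>) (pverts H)"
  have b: "bij_betw \<phi> (pverts H) ?N" using phi by (simp add: labelings_def)
  have "bij_betw (p \<circ> \<phi>) (pverts H) ?N"
    using b permutes_imp_bij[OF p] by (rule bij_betw_trans)
  then have b': "bij_betw ?\<phi> (pverts H) ?N" by (simp cong: bij_betw_cong)
  then show "?\<phi> \<in> labelings H" by (simp add: labelings_def)
  have inv: "the_inv_into (pverts H) ?\<phi> (p j) = the_inv_into (pverts H) \<phi> j" if "j \<in> ?N" for j
  proof -
    have "j \<in> \<phi> ` pverts H" using that unfolding bij_betw_imp_surj_on[OF b] .
    then obtain x where x: "x \<in> pverts H" "\<phi> x = j" by blast
    then have "the_inv_into (pverts H) \<phi> j = x"
      using b by (auto simp: bij_betw_def the_inv_into_f_f)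
    moreover have "the_inv_into (pverts H) ?\<phi> (?\<phi> x) = x"
      using b' x by (intro the_inv_into_f_f) (auto simp: bij_betw_def)
    ultimately show ?thesis using x by simp
  qed
  have k: "\<kappa> v \<in> ?N" if "v \<in> pverts G" for v
    using kappa that by (auto simp: proper_colorings_def)
  have "restrict (p \<circ> \<kappa>) (pverts G) \<in> pverts G \<rightarrow>\<^sub>E ?N"
    using k permutes_in_image[OF p] by (auto simp del: atLeastAtMost_iff)
  moreover have "(the_inv_into (pverts H) ?\<phi> (restrict (p \<circ> \<kappa>) (pverts G) u),
      the_inv_into (pverts H) ?\<phi> (restrict (p \<circ> \<kappa>) (pverts G) v)) \<in> parcs H"
    if uv: "(u, v) \<in> parcs G" for u v
  proof -
    have V: "u \<in> pverts G" "v \<in> pverts G"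
      using uv pair_wf_digraph.in_arcsD1[OF wf] pair_wf_digraph.in_arcsD2[OF wf] by blast+
    have "(the_inv_into (pverts H) \<phi> (\<kappa> u), the_inv_into (pverts H) \<phi> (\<kappa> v)) \<in> parcs H"
      using kappa uv by (auto simp: proper_colorings_def)
    with V inv[OF k] show ?thesis by simp
  qed
  ultimately show "restrict (p \<circ> \<kappa>) (pverts G) \<in> proper_colorings G H ?\<phi>"
    unfolding proper_colorings_def by blast
qed

lemma exponent_of_permute:
  assumes "p permutes A"
  shows "Poly_Mapping.lookup (exponent_of G (restrict (p \<circ> \<kappa>) (pverts G))) (p i) =
    Poly_Mapping.lookup (exponent_of G \<kappa>) i"
  unfolding lookup_exponent_of
  using permutes_inj[OF assms] by (intro sum.cong) (auto dest: injD)

lemma exponent_of_permute_eq_iff: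
  assumes p: "p permutes A"
    and e: "\<And>i. Poly_Mapping.lookup e' (p i) = Poly_Mapping.lookup e i"
  shows "exponent_of G (restrict (p \<circ> \<kappa>) (pverts G)) = e' \<longleftrightarrow> exponent_of G \<kappa> = e"
proof
  assume "exponent_of G (restrict (p \<circ> \<kappa>) (pverts G)) = e'"
  then show "exponent_of G \<kappa> = e"
    using e exponent_of_permute[OF p] by (metis poly_mapping_eqI)
next
  assume *: "exponent_of G \<kappa> = e"
  show "exponent_of G (restrict (p \<circ> \<kappa>) (pverts G)) = e'"
  proof (rule poly_mapping_eqI)
    fix j
    obtain i where "j = p i" using permutes_surj[OF p] by (metis surjD)
    then show "Poly_Mapping.lookup (exponent_of G (restrict (p \<circ> \<kappa>) (pverts G))) j =
        Poly_Mapping.lookup e' j"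
      using * e exponent_of_permute[OF p] by metis
  qed
qed

lemma H_chromatic_poly_symmetric:
  assumes G: "pair_wf_digraph G" "finite (pverts G)" and H: "finite (pverts H)"
    and p: "p permutes {1..card (pverts H)}"
    and e: "\<And>i. Poly_Mapping.lookup e' (p i) = Poly_Mapping.lookup e i"
  shows "Poly_Mapping.lookup (H_chromatic_poly G H) e = Poly_Mapping.lookup (H_chromatic_poly G H) e'"
proof -
  define act where "act q = (\<lambda>(\<phi>, \<kappa>). (restrict (q \<circ> \<phi>) (pverts H), restrict (q \<circ> \<kappa>) (pverts G)))"
    for q :: "nat \<Rightarrow> nat"
  let ?S = "Sigma (labelings H) (proper_colorings G H)"
  have closed: "act q x \<in> ?S" if "x \<in> ?S" "q permutes {1..card (pverts H)}" for q x
    using that permute_labeling_coloring[OF G(1) that(2)] by (auto simp: act_def)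
  have ext: "\<phi> \<in> extensional (pverts H)" "\<kappa> \<in> extensional (pverts G)" if "(\<phi>, \<kappa>) \<in> ?S" for \<phi> \<kappa>
    using that by (auto simp: labelings_def proper_colorings_def PiE_def)
  have cancel: "act q (act r x) = x" if "x \<in> ?S" "q \<circ> r = id" for q r x
  proof -
    have qr: "q (r i) = i" for i using that(2) by (metis comp_apply id_apply)
    obtain \<phi> \<kappa> where x: "x = (\<phi>, \<kappa>)" by (cases x)
    have ph: "\<phi> i = undefined" if "i \<notin> pverts H" for i
      using ext(1)[of \<phi> \<kappa>] \<open>x \<in> ?S\<close> x that by (simp add: extensional_def)
    have ka: "\<kappa> i = undefined" if "i \<notin> pverts G" for i
      using ext(2)[of \<phi> \<kappa>] \<open>x \<in> ?S\<close> x that by (simp add: extensional_def)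
    show ?thesis using ph ka by (auto simp: x act_def qr fun_eq_iff restrict_def)
  qed
  have ip: "inv p permutes {1..card (pverts H)}" using p by (rule permutes_inv)
  show ?thesis
    unfolding lookup_H_chromatic_poly[OF G(2) H]
  proof (rule sum.reindex_bij_witness[where j = "act p" and i = "act (inv p)"])
    fix x assume x: "x \<in> ?S"
    show "act (inv p) (act p x) = x" using x permutes_inv_o(2)[OF p] by (rule cancel)
    show "act p x \<in> ?S" using x p by (rule closed)
    show "(case act p x of (\<phi>, \<kappa>) \<Rightarrow> if exponent_of G \<kappa> = e' then 1 else 0) =
        (case x of (\<phi>, \<kappa>) \<Rightarrow> if exponent_of G \<kappa> = e then 1 else (0 :: int))"
      by (cases x) (simp add: act_def exponent_of_permute_eq_iff[OF p e])
  next
    fix x assume x: "x \<in> ?S"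
    show "act p (act (inv p) x) = x" using x permutes_inv_o(1)[OF p] by (rule cancel)
    show "act (inv p) x \<in> ?S" using x ip by (rule closed)
  qed
qed

lemma H_chromatic_poly_support:
  assumes G: "finite (pverts G)" and H: "finite (pverts H)"
    and nz: "Poly_Mapping.lookup (H_chromatic_poly G H) e \<noteq> 0"
  shows "Poly_Mapping.keys e \<subseteq> {1..card (pverts H)}"
    and "exponents e \<in> partitions (card (pverts G)) (card (pverts H))"
proof -
  have "\<exists>x \<in> Sigma (labelings H) (proper_colorings G H). exponent_of G (snd x) = e"
  proof (rule ccontr)
    assume "\<not> ?thesis"
    then have "Poly_Mapping.lookup (H_chromatic_poly G H) e = 0"
      unfolding lookup_H_chromatic_poly[OF G H] by (intro sum.neutral) auto
    with nz show False by simp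
  qed
  then obtain \<phi> \<kappa> where k: "\<kappa> \<in> proper_colorings G H \<phi>" and e: "e = exponent_of G \<kappa>" by auto
  have kr: "\<kappa> v \<in> {1..card (pverts H)}" if "v \<in> pverts G" for v
    using k that by (auto simp: proper_colorings_def)
  show keys: "Poly_Mapping.keys e \<subseteq> {1..card (pverts H)}"
  proof
    fix i assume "i \<in> Poly_Mapping.keys e"
    then have "(\<Sum>v \<in> pverts G. if \<kappa> v = i then 1 else 0) \<noteq> (0 :: nat)"
      unfolding in_keys_iff e lookup_exponent_of .
    then obtain v where "v \<in> pverts G" "(if \<kappa> v = i then 1 else 0) \<noteq> (0 :: nat)"
      by (rule sum.not_neutral_contains_not_neutral)
    then have "v \<in> pverts G" "\<kappa> v = i" by (auto split: if_splits)
    with kr show "i \<in> {1..card (pverts H)}" by blast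
  qed
  have "sum_mset (exponents e) = (\<Sum>i\<in>{1..card (pverts H)}. Poly_Mapping.lookup e i)"
    unfolding sum_exponents using keys by (intro sum.mono_neutral_left) (auto simp: in_keys_iff)
  also have "\<dots> = (\<Sum>v \<in> pverts G. \<Sum>i\<in>{1..card (pverts H)}. if \<kappa> v = i then 1 else 0)"
    unfolding e lookup_exponent_of by (rule sum.swap)
  also have "\<dots> = (\<Sum>v \<in> pverts G. 1)"
    using kr by (intro sum.cong refl) (simp add: sum.delta')
  finally have "sum_mset (exponents e) = card (pverts G)" by simp
  moreover have "size (exponents e) \<le> card (pverts H)"
    unfolding size_exponents using card_mono[OF _ keys] by simp
  moreover have "0 \<notin># exponents e" by (auto simp: exponents_def in_keys_iff)
  ultimately show "exponents e \<in> partitions (card (pverts G)) (card (pverts H))"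
    by (simp add: partitions_def)
qed

lemma ex1_monomial_expansion:
  assumes "simple_graph G" "simple_graph H"
  shows "\<exists>!c. is_monomial_expansion G H c"
proof -
  interpret G: pair_graph G using assms by (simp add: simple_graph_def)
  interpret H: pair_graph H using assms by (simp add: simple_graph_def)
  note fin = G.pair_finite_verts H.pair_finite_verts
  let ?N = "card (pverts H)"
  let ?P = "partitions (card (pverts G)) ?N"
  let ?w = "H_chromatic_poly G H"
  define rep where "rep l = (SOME e. Poly_Mapping.keys e \<subseteq> {1..?N} \<and> exponents e = l)" for l
  have rep: "Poly_Mapping.keys (rep l) \<subseteq> {1..?N}" "exponents (rep l) = l" if "l \<in> ?P" for l
    using someI_ex[OF ex_exponents[OF that]] by (simp_all add: rep_def)
  define c where "c l = (if l \<in> ?P then Poly_Mapping.lookup ?w (rep l) else 0)" for l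
  have "is_monomial_expansion G H c"
    unfolding is_monomial_expansion_def
  proof (intro conjI allI impI poly_mapping_eqI)
    fix e
    show "Poly_Mapping.lookup ?w e =
        Poly_Mapping.lookup (\<Sum>l \<in> ?P. of_int (c l) * monomial_sym_poly ?N l) e"
    proof (cases "Poly_Mapping.keys e \<subseteq> {1..?N} \<and> exponents e \<in> ?P")
      case True
      then obtain p where "p permutes {1..?N}"
          "\<And>i. Poly_Mapping.lookup (rep (exponents e)) (p i) = Poly_Mapping.lookup e i"
        using exponents_eq_imp_permutes[of e ?N "rep (exponents e)"] rep by metis
      then have "Poly_Mapping.lookup ?w e = Poly_Mapping.lookup ?w (rep (exponents e))"
        using fin G.pair_wf_digraph_axioms by (intro H_chromatic_poly_symmetric) auto
      then show ?thesis using True by (simp add: lookup_expansion c_def)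
    next
      case False
      then have "Poly_Mapping.lookup ?w e = 0" using H_chromatic_poly_support[OF fin] by blast
      then show ?thesis using False by (simp only: lookup_expansion if_False)
    qed
  qed (simp add: c_def)
  moreover have "d = d'" if d: "is_monomial_expansion G H d" and d': "is_monomial_expansion G H d'" for d d'
  proof
    fix l
    show "d l = d' l"
    proof (cases "l \<in> ?P")
      case True
      have "Poly_Mapping.lookup ?w (rep l) = b l" if "is_monomial_expansion G H b" for b
      proof -
        have "?w = (\<Sum>l \<in> ?P. of_int (b l) * monomial_sym_poly ?N l)"
          using that unfolding is_monomial_expansion_def by blast
        then show ?thesis using True rep[OF True] by (simp add: lookup_expansion)
      qed
      with d d' show ?thesis by metis
    qed (use d d' in \<open>simp add: is_monomial_expansion_def\<close>)
  qed
  ultimately show ?thesis by blast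
qed

end

theory Submission
  imports Defs
begin

text \<open>
  A proper coloring of a star only constrains the neighbourhood of the vertex of \<open>H\<close> that carries
  the colour of the centre. Equal degree sequences yield a degree-preserving bijection \<open>f\<close> between
  the vertex sets of \<open>H1\<close> and \<open>H2\<close>, and each vertex \<open>v\<close> extends to a bijection \<open>g v\<close> of the vertex
  sets that sends \<open>v\<close> to \<open>f v\<close> and the neighbours of \<open>v\<close> to those of \<open>f v\<close>. Keeping the coloring
  and transporting the labeling along \<open>g v\<close>, where \<open>v\<close> is the vertex labeled by the colour of the
  centre, injects the pairs of a labeling and a proper coloring for \<open>H1\<close> into those for \<open>H2\<close>
  without changing the monomial.
\<close>

section \<open>Bijections assembled from fibers\<close>

text \<open>Finite sets of equal size are in bijection, and the fibers partition \<open>A\<close>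
  and \<open>B\<close>, so bijections between fibers over the same value glue. This yields both the
  degree-preserving bijection and, with a three-valued map, the pointed one.\<close>

lemma bij_betw_fibers:
  assumes "finite A" "finite B"
    and card: "\<And>j. card {x \<in> A. f x = j} = card {y \<in> B. g y = j}"
  obtains h where "bij_betw h A B" "\<And>x. x \<in> A \<Longrightarrow> g (h x) = f x"
proof -
  have "\<exists>h. bij_betw h {x \<in> A. f x = j} {y \<in> B. g y = j}" for j
    using assms by (intro finite_same_card_bij) auto
  then obtain h where h: "\<And>j. bij_betw (h j) {x \<in> A. f x = j} {y \<in> B. g y = j}"
    by metis
  \<comment> \<open>Each point is moved by the bijection of its own fiber.\<close>
  let ?h = "\<lambda>x. h (f x) x"
  have into: "?h x \<in> B \<and> g (?h x) = f x" if "x \<in> A" for x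
    using bij_betwE[OF h[of "f x"]] that by blast
  have "inj_on ?h A"
  proof (rule inj_onI)
    fix x y assume xy: "x \<in> A" "y \<in> A" "?h x = ?h y"
    then have "f x = f y" using into by metis
    then show "x = y" using xy bij_betw_imp_inj_on[OF h[of "f y"]] by (auto dest: inj_onD)
  qed
  moreover have "y \<in> ?h ` A" if "y \<in> B" for y
  proof -
    have "y \<in> h (g y) ` {x \<in> A. f x = g y}"
      using that bij_betw_imp_surj_on[OF h[of "g y"]] by blast
    then obtain x where "x \<in> A" "f x = g y" "y = h (g y) x" by blast
    then have "y = ?h x" by simp
    with \<open>x \<in> A\<close> show ?thesis by (rule rev_image_eqI)
  qed
  ultimately have "bij_betw ?h A B" using into by (auto simp: bij_betw_def)
  then show ?thesis using into that by blast
qed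

text \<open>The point, the distinguished subset and the remaining elements are the three fibers of a
  map; their sizes agree on both sides, so \<open>bij_betw_fibers\<close> applies.\<close>

lemma ex_pointed_bij_betw:
  assumes "finite A" "finite B" "card A = card B"
    and "P \<subseteq> A" "Q \<subseteq> B" "card P = card Q"
    and "a \<in> A - P" "b \<in> B - Q"
  obtains g where "bij_betw g A B" "g a = b" "\<And>x. x \<in> P \<Longrightarrow> g x \<in> Q"
proof -
  \<comment> \<open>The codes 0, 1, 2 stand for the point, the subset and the rest.\<close>
  have A: "{x \<in> A. (if x = a then 0 else if x \<in> P then 1 else 2) = j} =
      (if j = 0 then {a} else if j = 1 then P else if j = 2 then A - insert a P else {})" for j :: nat
    using assms by auto
  have B: "{x \<in> B. (if x = b then 0 else if x \<in> Q then 1 else 2) = j} =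
      (if j = 0 then {b} else if j = 1 then Q else if j = 2 then B - insert b Q else {})" for j :: nat
    using assms by auto
  have fin: "finite P" "finite Q" using assms finite_subset by blast+
  have "card (A - insert a P) = card (B - insert b Q)"
    using assms fin by (simp add: card_Diff_subset)
  then have "card {x \<in> A. (if x = a then 0 else if x \<in> P then 1 else 2) = j} =
      card {x \<in> B. (if x = b then 0 else if x \<in> Q then 1 else 2) = j}" for j :: nat
    unfolding A B using assms by simp
  then obtain g where g: "bij_betw g A B"
      "\<And>x. x \<in> A \<Longrightarrow> (if g x = b then 0 else if g x \<in> Q then 1 else 2) =
        (if x = a then 0 else if x \<in> P then 1 else (2 :: nat))"
    by (rule bij_betw_fibers[OF assms(1,2)]) blast
  have "g a = b" using g(2)[of a] assms by (auto split: if_splits)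
  moreover have "g x \<in> Q" if "x \<in> P" for x
    using g(2)[of x] assms that by (auto split: if_splits)
  ultimately show ?thesis using g(1) that by blast
qed

section \<open>Neighborhoods and degree counts\<close>

definition nbrs :: "'a pair_pre_digraph \<Rightarrow> 'a \<Rightarrow> 'a set" where
  "nbrs H v = {w. (v, w) \<in> parcs H}"

lemma out_degree_eq_card_nbrs: "out_degree (with_proj H) v = card (nbrs H v)"
proof -
  have "out_arcs (with_proj H) v = Pair v ` nbrs H v"
    by (auto simp: out_arcs_def nbrs_def)
  then show ?thesis by (simp add: out_degree_def card_image inj_on_def)
qed

lemma nbrs_subset:
  assumes "pair_graph H"
  shows "nbrs H v \<subseteq> pverts H - {v}"
proof -
  interpret pair_graph H by fact
  show ?thesis using in_arcsD2 pair_no_loops by (fastforce simp: nbrs_def)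
qed

text \<open>The degree sequence records only degrees from 1 to the number of vertices. Larger
  degrees do not occur, and the count for degree 0 follows by subtracting all others from the common
  number of vertices.\<close>

lemma card_degree_fiber_eq:
  assumes H1: "pair_graph H1" and H2: "pair_graph H2"
    and card: "card (pverts H1) = card (pverts H2)"
    and deg: "degree_sequence H1 = degree_sequence H2"
  shows "card {v \<in> pverts H1. card (nbrs H1 v) = j} = card {v \<in> pverts H2. card (nbrs H2 v) = j}"
proof -
  interpret H1: pair_graph H1 by fact
  interpret H2: pair_graph H2 by fact
  let ?F1 = "\<lambda>j. {v \<in> pverts H1. card (nbrs H1 v) = j}"
  let ?F2 = "\<lambda>j. {v \<in> pverts H2. card (nbrs H2 v) = j}"
  let ?k = "card (pverts H2)"
  have le1: "card (nbrs H1 v) \<le> ?k" for v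
    unfolding card[symmetric] using nbrs_subset[OF H1] H1.pair_finite_verts by (intro card_mono) auto
  have le2: "card (nbrs H2 v) \<le> ?k" for v
    using nbrs_subset[OF H2] H2.pair_finite_verts by (intro card_mono) auto
  have pos: "card (?F1 j) = card (?F2 j)" if "j \<in> {1..?k}" for j
    using deg that unfolding degree_sequence_def out_degree_eq_card_nbrs card
    by (simp del: upt_Suc add: map_eq_conv)
  \<comment> \<open>By \<open>le1\<close> and \<open>le2\<close> the fibers over
    \<open>0..?k\<close> exhaust the vertex sets.\<close>
  have "card (pverts H1) = (\<Sum>j\<in>{0..?k}. card (?F1 j))"
    using le1 H1.pair_finite_verts
    by (subst card_UN_disjoint[symmetric]) (auto intro!: arg_cong[where f = card])
  moreover have "card (pverts H2) = (\<Sum>j\<in>{0..?k}. card (?F2 j))"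
    using le2 H2.pair_finite_verts
    by (subst card_UN_disjoint[symmetric]) (auto intro!: arg_cong[where f = card])
  moreover have "(\<Sum>j\<in>{1..?k}. card (?F1 j)) = (\<Sum>j\<in>{1..?k}. card (?F2 j))"
    using pos by (rule sum.cong[OF refl])
  ultimately have zero: "card (?F1 0) = card (?F2 0)"
    using card by (simp add: sum.atLeast_Suc_atMost[of 0])
  consider "j = 0" | "j \<in> {1..?k}" | "j > ?k" by force
  then show ?thesis
  proof cases
    case 3
    then have "card (nbrs H1 v) \<noteq> j" "card (nbrs H2 w) \<noteq> j" for v w
      using le1[of v] le2[of w] by linarith+
    then have "?F1 j = {}" "?F2 j = {}" by blast+
    then show ?thesis by (simp only: card.empty)
  qed (use zero pos in auto)
qed

section \<open>Colorings of stars and their transport\<close>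

lemma the_inv_into_labeling:
  assumes "\<phi> \<in> labelings H" "i \<in> {1..card (pverts H)}"
  shows "the_inv_into (pverts H) \<phi> i \<in> pverts H" "\<phi> (the_inv_into (pverts H) \<phi> i) = i"
  using assms bij_betwE[OF bij_betw_the_inv_into] f_the_inv_into_f_bij_betw
  by (fastforce simp: labelings_def)+

text \<open>Every arc of the star joins the center \<open>c\<close> to a leaf, and symmetry of
  \<open>parcs H\<close> makes the two arcs of an edge impose the same condition.\<close>

lemma proper_coloring_star_iff:
  assumes H: "pair_graph H" and E: "parcs G = {c} \<times> L \<union> L \<times> {c}"
  shows "\<kappa> \<in> proper_colorings G H \<phi> \<longleftrightarrow>
    \<kappa> \<in> pverts G \<rightarrow>\<^sub>E {1..card (pverts H)} \<and>
    (\<forall>u \<in> L. the_inv_into (pverts H) \<phi> (\<kappa> u) \<in> nbrs H (the_inv_into (pverts H) \<phi> (\<kappa> c)))"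
proof -
  interpret pair_graph H by fact
  have "(x, y) \<in> parcs H \<longleftrightarrow> (y, x) \<in> parcs H" for x y
    using arcs_symmetric by blast
  moreover have "(\<forall>(u, v) \<in> {c} \<times> L \<union> L \<times> {c}. P u v) \<longleftrightarrow> (\<forall>u \<in> L. P c u \<and> P u c)" for P
    by fastforce
  ultimately show ?thesis
    unfolding proper_colorings_def E nbrs_def by auto
qed

text \<open>Each coefficient counts pairs of a labeling and a coloring with a given monomial, so a
  monomial-preserving injection gives an inequality. The hypotheses are symmetric in
  \<open>H1\<close> and \<open>H2\<close>, so equality comes from using it both ways.\<close>

lemma lookup_star_chromatic_poly_le:
  fixes H1 :: "'b pair_pre_digraph" and H2 :: "'c pair_pre_digraph"
  assumes H1: "pair_graph H1" and H2: "pair_graph H2"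
    and card: "card (pverts H1) = card (pverts H2)"
    and deg: "degree_sequence H1 = degree_sequence H2"
    and G: "finite (pverts G)" "pverts G = insert c L" "parcs G = {c} \<times> L \<union> L \<times> {c}"
  shows "Poly_Mapping.lookup (H_chromatic_poly G H1) e \<le> Poly_Mapping.lookup (H_chromatic_poly G H2) e"
proof -
  interpret H1: pair_graph H1 by fact
  interpret H2: pair_graph H2 by fact
  note fin = H1.pair_finite_verts H2.pair_finite_verts
  let ?V1 = "pverts H1" and ?V2 = "pverts H2"
  let ?N = "{1..card ?V2}"
  let ?S1 = "Sigma (labelings H1) (proper_colorings G H1)"
  let ?S2 = "Sigma (labelings H2) (proper_colorings G H2)"
  obtain f where f: "bij_betw f ?V1 ?V2" "\<And>v. v \<in> ?V1 \<Longrightarrow> card (nbrs H2 (f v)) = card (nbrs H1 v)"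
    using bij_betw_fibers[OF fin card_degree_fiber_eq[OF H1 H2 card deg]] by blast
  \<comment> \<open>As \<open>f\<close> preserves degrees, the neighborhoods of \<open>v\<close> and
    \<open>f v\<close> have equal size; having no loops keeps \<open>v\<close> and
    \<open>f v\<close> outside them.\<close>
  have "\<exists>g. bij_betw g ?V1 ?V2 \<and> g v = f v \<and> (\<forall>x \<in> nbrs H1 v. g x \<in> nbrs H2 (f v))"
    if v: "v \<in> ?V1" for v
    by (rule ex_pointed_bij_betw[OF fin card, of "nbrs H1 v" "nbrs H2 (f v)" v "f v"])
      (use v f nbrs_subset[OF H1, of v] nbrs_subset[OF H2, of "f v"] bij_betwE[OF f(1)] in auto)
  then obtain g where g: "\<And>v. v \<in> ?V1 \<Longrightarrow> bij_betw (g v) ?V1 ?V2"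
      "\<And>v. v \<in> ?V1 \<Longrightarrow> g v v = f v"
      "\<And>v x. v \<in> ?V1 \<Longrightarrow> x \<in> nbrs H1 v \<Longrightarrow> g v x \<in> nbrs H2 (f v)"
    by metis
  define ctr where "ctr = (\<lambda>(\<phi> :: 'b \<Rightarrow> nat, \<kappa> :: 'a \<Rightarrow> nat). the_inv_into ?V1 \<phi> (\<kappa> c))"
  \<comment> \<open>The new label of \<open>g v x\<close> is the old label of \<open>x\<close>,
    where \<open>v\<close> is \<open>ctr (\<phi>, \<kappa>)\<close>; \<open>restrict\<close> makes
    the new labeling extensional.\<close>
  define T where "T = (\<lambda>(\<phi>, \<kappa>).
    (restrict (\<phi> \<circ> the_inv_into ?V1 (g (ctr (\<phi>, \<kappa>)))) ?V2, \<kappa>))"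
  have S1: "\<phi> \<in> labelings H1" "bij_betw \<phi> ?V1 ?N" "\<And>u. u \<in> pverts G \<Longrightarrow> \<kappa> u \<in> ?N"
      "ctr (\<phi>, \<kappa>) \<in> ?V1" "\<phi> (ctr (\<phi>, \<kappa>)) = \<kappa> c"
    if "(\<phi>, \<kappa>) \<in> ?S1" for \<phi> \<kappa>
  proof -
    show \<phi>: "\<phi> \<in> labelings H1" using that by simp
    then show "bij_betw \<phi> ?V1 ?N" by (simp add: labelings_def card)
    show \<kappa>: "\<kappa> u \<in> ?N" if "u \<in> pverts G" for u
      using \<open>(\<phi>, \<kappa>) \<in> ?S1\<close> that by (auto simp: proper_colorings_def card)
    have "\<kappa> c \<in> {1..card ?V1}" using \<kappa>[of c] G(2) card by simp
    then show "ctr (\<phi>, \<kappa>) \<in> ?V1" "\<phi> (ctr (\<phi>, \<kappa>)) = \<kappa> c"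
      using the_inv_into_labeling[OF \<phi>] by (simp_all add: ctr_def)
  qed
  have fstT: "fst (T (\<phi>, \<kappa>)) (g (ctr (\<phi>, \<kappa>)) x) = \<phi> x"
    if S: "(\<phi>, \<kappa>) \<in> ?S1" and x: "x \<in> ?V1" for \<phi> \<kappa> x
  proof -
    note b = g(1)[OF S1(4)[OF S]]
    show ?thesis
      using bij_betwE[OF b] x the_inv_into_f_f[OF bij_betw_imp_inj_on[OF b] x] by (simp add: T_def)
  qed
  have bijT: "bij_betw (fst (T (\<phi>, \<kappa>))) ?V2 ?N" if S: "(\<phi>, \<kappa>) \<in> ?S1" for \<phi> \<kappa>
  proof -
    have "bij_betw (\<phi> \<circ> the_inv_into ?V1 (g (ctr (\<phi>, \<kappa>)))) ?V2 ?N"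
      using bij_betw_the_inv_into[OF g(1)[OF S1(4)[OF S]]] S1(2)[OF S] by (rule bij_betw_trans)
    then show ?thesis by (simp add: T_def cong: bij_betw_cong)
  qed
  have invT: "the_inv_into ?V2 (fst (T (\<phi>, \<kappa>))) i = g (ctr (\<phi>, \<kappa>)) (the_inv_into ?V1 \<phi> i)"
    if S: "(\<phi>, \<kappa>) \<in> ?S1" and i: "i \<in> ?N" for \<phi> \<kappa> i
  proof -
    let ?x = "the_inv_into ?V1 \<phi> i"
    have x: "?x \<in> ?V1" "\<phi> ?x = i"
      using the_inv_into_labeling[OF S1(1)[OF S]] i by (simp_all add: card)
    have "g (ctr (\<phi>, \<kappa>)) ?x \<in> ?V2" using bij_betwE[OF g(1)[OF S1(4)[OF S]]] x by blast
    with bijT[OF S] fstT[OF S x(1)] x(2) show ?thesis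
      by (metis bij_betw_imp_inj_on the_inv_into_f_f)
  qed
  have invT_c: "the_inv_into ?V2 (fst (T (\<phi>, \<kappa>))) (\<kappa> c) = f (ctr (\<phi>, \<kappa>))"
    if S: "(\<phi>, \<kappa>) \<in> ?S1" for \<phi> \<kappa>
    using invT[OF S S1(3)[OF S]] g(2)[OF S1(4)[OF S]] G(2) by (simp add: ctr_def)
  have T_mem: "T x \<in> ?S2" if "x \<in> ?S1" for x
  proof -
    obtain \<phi> \<kappa> where x: "x = (\<phi>, \<kappa>)" by (cases x)
    with that have S: "(\<phi>, \<kappa>) \<in> ?S1" by simp
    have "fst (T (\<phi>, \<kappa>)) \<in> labelings H2"
      using bijT[OF S] by (simp add: labelings_def T_def)
    moreover have "\<kappa> \<in> proper_colorings G H2 (fst (T (\<phi>, \<kappa>)))"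
      unfolding proper_coloring_star_iff[OF H2 G(3)] invT_c[OF S]
    proof (intro conjI ballI)
      have k: "\<kappa> \<in> proper_colorings G H1 \<phi>" using S by simp
      then show "\<kappa> \<in> pverts G \<rightarrow>\<^sub>E ?N" by (simp add: proper_colorings_def card)
      fix u assume u: "u \<in> L"
      have "the_inv_into ?V1 \<phi> (\<kappa> u) \<in> nbrs H1 (ctr (\<phi>, \<kappa>))"
        using k u unfolding proper_coloring_star_iff[OF H1 G(3)] by (simp add: ctr_def)
      then show "the_inv_into ?V2 (fst (T (\<phi>, \<kappa>))) (\<kappa> u) \<in> nbrs H2 (f (ctr (\<phi>, \<kappa>)))"
        using invT[OF S S1(3)[OF S]] u G(2) g(3)[OF S1(4)[OF S]] by simp
    qed
    ultimately show ?thesis by (simp add: x T_def)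
  qed
  \<comment> \<open>The bijection used to transport \<open>\<phi>\<close> depends on
    \<open>\<phi>\<close> itself, but by \<open>invT_c\<close> the image reveals
    \<open>f (ctr (\<phi>, \<kappa>))\<close>. Injectivity of \<open>f\<close> then recovers the
    center, hence the bijection, and \<open>fstT\<close> recovers \<open>\<phi>\<close>.\<close>
  have T_inj: "inj_on T ?S1"
  proof (rule inj_onI)
    fix x y assume xy: "x \<in> ?S1" "y \<in> ?S1" "T x = T y"
    obtain \<phi> \<kappa> where x: "x = (\<phi>, \<kappa>)" by (cases x)
    moreover obtain \<psi> where y: "y = (\<psi>, \<kappa>)" using xy(3) x by (cases y) (simp add: T_def)
    ultimately have S: "(\<phi>, \<kappa>) \<in> ?S1" "(\<psi>, \<kappa>) \<in> ?S1" and eq: "T (\<phi>, \<kappa>) = T (\<psi>, \<kappa>)"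
      using xy by auto
    have "f (ctr (\<phi>, \<kappa>)) = f (ctr (\<psi>, \<kappa>))"
      using invT_c[OF S(1)] invT_c[OF S(2)] eq by simp
    then have "ctr (\<phi>, \<kappa>) = ctr (\<psi>, \<kappa>)"
      using inj_onD[OF bij_betw_imp_inj_on[OF f(1)]] S1(4)[OF S(1)] S1(4)[OF S(2)] by blast
    then have "\<phi> v = \<psi> v" if "v \<in> ?V1" for v
      using fstT[OF S(1) that] fstT[OF S(2) that] eq by simp
    moreover have "\<phi> \<in> extensional ?V1" "\<psi> \<in> extensional ?V1"
      using S by (auto simp: labelings_def)
    ultimately have "\<phi> = \<psi>" by (intro extensionalityI)
    then show "x = y" using x y by simp
  qed
  have "Poly_Mapping.lookup (H_chromatic_poly G H1) e =
      (\<Sum>(\<phi>, \<kappa>) \<in> T ` ?S1. if exponent_of G \<kappa> = e then 1 else 0)"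
    unfolding lookup_H_chromatic_poly[OF G(1) fin(1)] sum.reindex[OF T_inj]
    by (intro sum.cong) (auto simp: T_def)
  also have "\<dots> \<le> (\<Sum>(\<phi>, \<kappa>) \<in> ?S2. if exponent_of G \<kappa> = e then 1 else 0)"
  proof (rule sum_mono2)
    show "finite ?S2"
      using G(1) fin(2) by (simp add: finite_labelings finite_proper_colorings)
    show "T ` ?S1 \<subseteq> ?S2" using T_mem by (rule image_subsetI)
  qed auto
  finally show ?thesis unfolding lookup_H_chromatic_poly[OF G(1) fin(2)] .
qed

theorem corollary8p10:
  fixes G :: "'a pair_pre_digraph"
    and H1 :: "'b pair_pre_digraph"
    and H2 :: "'c pair_pre_digraph"
    and k :: nat
  assumes "simple_graph H1" and "card (pverts H1) = k"
    and "simple_graph H2" and "card (pverts H2) = k"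
    and "star_graph G"
    and "degree_sequence H1 = degree_sequence H2"
  shows "H_chromatic_sym G H1 = H_chromatic_sym G H2"
proof -
  have H: "pair_graph H1" "pair_graph H2"
    using assms by (simp_all add: simple_graph_def)
  have card: "card (pverts H1) = card (pverts H2)" using assms by simp
  \<comment> \<open>\<open>U\<close> is the side of the bipartition with one vertex, the center of
    the star.\<close>
  obtain U L where G: "finite (pverts G)" "pverts G = U \<union> L" "card U = 1"
      "parcs G = U \<times> L \<union> L \<times> U"
    using \<open>star_graph G\<close> unfolding star_graph_def complete_bipartite_digraph_pair_def by blast
  obtain c where "U = {c}" using G(3) by (rule card_1_singletonE)
  with G have star: "pverts G = insert c L" "parcs G = {c} \<times> L \<union> L \<times> {c}" by auto
  have "H_chromatic_poly G H1 = H_chromatic_poly G H2"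
    using lookup_star_chromatic_poly_le[OF H card assms(6) G(1) star]
      lookup_star_chromatic_poly_le[OF H(2,1) card[symmetric] assms(6)[symmetric] G(1) star]
    by (intro poly_mapping_eqI antisym)
  \<comment> \<open>Equal polynomials and equal vertex counts make the two predicates
    \<open>is_monomial_expansion\<close> coincide, so \<open>THE\<close> selects the same
    coefficients.\<close>
  then show ?thesis
    unfolding H_chromatic_sym_def monomial_coeff_def is_monomial_expansion_def card by simp
qed

end
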